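(* Let $\mathbb{K}$ be a field, let $P$ be a finite partially ordered set, and let $S$ be a semi-component module over $P$. Then $S$ arises as a summand of a component module: there exist a component module $C$ over $P$ and an interval module $I$ over $P$ such that $$C\cong S\oplus I.$$
   Context: A partially ordered set $P$ is viewed as a category with one object for each element and a unique morphism $p\to q$ whenever $p\le q$. A persistence module over $P$ is a functor from $P$ to the category of finite-dimensional $\mathbb{K}$-vector spaces and linear maps. Direct sums are taken objectwise. A persistence module $M$ over $P$ is a component module if there is a choice of basis of every vector space $M(q)$, $q\in P$, such that for every morphism $\alpha\colon q\to p$ in $P$ the matrix of $M(\alpha)$ with respect to these bases contains only zeros and ones, with exactly one $1$ in each column. If instead the matrices contain only zeros and ones with at most one $1$ in each column, $M$ is called a semi-component module. A persistence module $M$ over $P$ is an interval module if: (1) for every $p\in P$, $M(p)$ is isomorphic to $\mathbb{K}$ or $0$; (2) bases can be chosen simultaneously such that for every morphism $\alpha\colon q\to p$ with $M(q)\cong M(p)\cong\mathbb{K}$ the map $M(\alpha)$ is the identity; (3) for morphisms $q\to p$ and $p\to l$ in $P$, if $M(q)\cong M(l)\cong\mathbb{K}$ then $M(p)\cong\mathbb{K}$. *)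

theory Defs
  imports "HOL-Analysis.Product_Vector"
begin

text \<open>
  The poset is a carrier set \<open>P\<close> with an order relation \<open>r\<close>, where \<open>(q, p) \<in> r\<close> means
  \<open>q \<le> p\<close>. The vector spaces \<open>M(q)\<close> of a module are finite-dimensional subspaces of one
  ambient vector space of arbitrary dimension, whose scalar multiplication is passed as \<open>s\<close>;
  up to isomorphism every module has this form. Structure maps are functions on the ambient
  type of which only the restriction to the respective \<open>M(q)\<close> is relevant.
\<close>

record ('p, 'v) pmod =
  space_at :: "'p \<Rightarrow> 'v set"
  map_at :: "'p \<Rightarrow> 'p \<Rightarrow> 'v \<Rightarrow> 'v"

definition is_basis :: "('k::field \<Rightarrow> 'v::ab_group_add \<Rightarrow> 'v) \<Rightarrow> 'v set \<Rightarrow> 'v set \<Rightarrow> bool" where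
  "is_basis s V B \<longleftrightarrow> \<not> module.dependent s B \<and> module.span s B = V"

definition fin_dim_subspace :: "('k::field \<Rightarrow> 'v::ab_group_add \<Rightarrow> 'v) \<Rightarrow> 'v set \<Rightarrow> bool" where
  "fin_dim_subspace s V \<longleftrightarrow> module.subspace s V \<and> (\<exists>B. finite B \<and> is_basis s V B)"

definition linear_map ::
  "('k::field \<Rightarrow> 'v::ab_group_add \<Rightarrow> 'v) \<Rightarrow> ('k \<Rightarrow> 'w::ab_group_add \<Rightarrow> 'w)
    \<Rightarrow> 'v set \<Rightarrow> 'w set \<Rightarrow> ('v \<Rightarrow> 'w) \<Rightarrow> bool" where
  "linear_map s t V W f \<longleftrightarrow>
     (\<forall>x\<in>V. f x \<in> W) \<and>
     (\<forall>x\<in>V. \<forall>y\<in>V. f (x + y) = f x + f y) \<and>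
     (\<forall>c. \<forall>x\<in>V. f (s c x) = t c (f x))"

definition linear_iso ::
  "('k::field \<Rightarrow> 'v::ab_group_add \<Rightarrow> 'v) \<Rightarrow> ('k \<Rightarrow> 'w::ab_group_add \<Rightarrow> 'w)
    \<Rightarrow> 'v set \<Rightarrow> 'w set \<Rightarrow> ('v \<Rightarrow> 'w) \<Rightarrow> bool" where
  "linear_iso s t V W f \<longleftrightarrow> linear_map s t V W f \<and> bij_betw f V W"

definition persistence_module ::
  "'p set \<Rightarrow> 'p rel \<Rightarrow> ('k::field \<Rightarrow> 'v::ab_group_add \<Rightarrow> 'v) \<Rightarrow> ('p, 'v) pmod \<Rightarrow> bool" where
  "persistence_module P r s M \<longleftrightarrow>
     vector_space s \<and>
     (\<forall>q\<in>P. fin_dim_subspace s (space_at M q)) \<and>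
     (\<forall>(q, p)\<in>r. linear_map s s (space_at M q) (space_at M p) (map_at M q p)) \<and>
     (\<forall>q\<in>P. \<forall>x\<in>space_at M q. map_at M q q x = x) \<and>
     (\<forall>q p l. (q, p) \<in> r \<longrightarrow> (p, l) \<in> r \<longrightarrow>
        (\<forall>x\<in>space_at M q. map_at M q l x = map_at M p l (map_at M q p x)))"

definition isomorphic_modules ::
  "'p set \<Rightarrow> 'p rel \<Rightarrow> ('k::field \<Rightarrow> 'v::ab_group_add \<Rightarrow> 'v) \<Rightarrow> ('k \<Rightarrow> 'w::ab_group_add \<Rightarrow> 'w)
    \<Rightarrow> ('p, 'v) pmod \<Rightarrow> ('p, 'w) pmod \<Rightarrow> bool" where
  "isomorphic_modules P r s t M N \<longleftrightarrow>
     (\<exists>\<phi>. (\<forall>q\<in>P. linear_iso s t (space_at M q) (space_at N q) (\<phi> q)) \<and>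
          (\<forall>(q, p)\<in>r. \<forall>x\<in>space_at M q. \<phi> p (map_at M q p x) = map_at N q p (\<phi> q x)))"

text \<open>The scalar multiplication belonging to \<open>direct_sum\<close> is \<^const>\<open>module_prod.scale\<close>.\<close>

definition direct_sum :: "('p, 'v) pmod \<Rightarrow> ('p, 'w) pmod \<Rightarrow> ('p, 'v \<times> 'w) pmod" where
  "direct_sum M N =
     \<lparr>space_at = (\<lambda>q. space_at M q \<times> space_at N q),
      map_at = (\<lambda>q p. map_prod (map_at M q p) (map_at N q p))\<rparr>"

text \<open>
  Entry in row \<open>b'\<close> and column \<open>b\<close> of the matrix of \<open>f\<close> with respect to a basis of the
  source containing \<open>b\<close> and the basis \<open>B'\<close> of the target.
\<close>

definition matrix_entry ::
  "('k::field \<Rightarrow> 'v::ab_group_add \<Rightarrow> 'v) \<Rightarrow> 'v set \<Rightarrow> ('v \<Rightarrow> 'v) \<Rightarrow> 'v \<Rightarrow> 'v \<Rightarrow> 'k" where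
  "matrix_entry s B' f b' b = module.representation s B' (f b) b'"

definition component_module ::
  "'p set \<Rightarrow> 'p rel \<Rightarrow> ('k::field \<Rightarrow> 'v::ab_group_add \<Rightarrow> 'v) \<Rightarrow> ('p, 'v) pmod \<Rightarrow> bool" where
  "component_module P r s M \<longleftrightarrow>
     persistence_module P r s M \<and>
     (\<exists>B. (\<forall>q\<in>P. is_basis s (space_at M q) (B q)) \<and>
          (\<forall>(q, p)\<in>r. \<forall>b\<in>B q.
             (\<forall>b'\<in>B p. matrix_entry s (B p) (map_at M q p) b' b \<in> {0, 1}) \<and>
             (\<exists>!b'. b' \<in> B p \<and> matrix_entry s (B p) (map_at M q p) b' b = 1)))"

definition semi_component_module ::
  "'p set \<Rightarrow> 'p rel \<Rightarrow> ('k::field \<Rightarrow> 'v::ab_group_add \<Rightarrow> 'v) \<Rightarrow> ('p, 'v) pmod \<Rightarrow> bool" where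
  "semi_component_module P r s M \<longleftrightarrow>
     persistence_module P r s M \<and>
     (\<exists>B. (\<forall>q\<in>P. is_basis s (space_at M q) (B q)) \<and>
          (\<forall>(q, p)\<in>r. \<forall>b\<in>B q.
             (\<forall>b'\<in>B p. matrix_entry s (B p) (map_at M q p) b' b \<in> {0, 1}) \<and>
             (\<exists>\<^sub>\<le>\<^sub>1b'. b' \<in> B p \<and> matrix_entry s (B p) (map_at M q p) b' b = 1)))"

definition iso_to_field :: "('k::field \<Rightarrow> 'v::ab_group_add \<Rightarrow> 'v) \<Rightarrow> 'v set \<Rightarrow> bool" where
  "iso_to_field s V \<longleftrightarrow> (\<exists>f. linear_iso s ((*) :: 'k \<Rightarrow> 'k \<Rightarrow> 'k) V UNIV f)"

text \<open>
  In the second condition \<open>B q\<close> and \<open>B p\<close> are singletons, so the map is the identity in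
  these bases iff the only entry of its matrix is 1.
\<close>

definition interval_module ::
  "'p set \<Rightarrow> 'p rel \<Rightarrow> ('k::field \<Rightarrow> 'v::ab_group_add \<Rightarrow> 'v) \<Rightarrow> ('p, 'v) pmod \<Rightarrow> bool" where
  "interval_module P r s M \<longleftrightarrow>
     persistence_module P r s M \<and>
     (\<forall>p\<in>P. iso_to_field s (space_at M p) \<or> space_at M p = {0}) \<and>
     (\<exists>B. (\<forall>q\<in>P. is_basis s (space_at M q) (B q)) \<and>
          (\<forall>(q, p)\<in>r. iso_to_field s (space_at M q) \<longrightarrow> iso_to_field s (space_at M p) \<longrightarrow>
             (\<forall>b\<in>B q. \<forall>b'\<in>B p. matrix_entry s (B p) (map_at M q p) b' b = 1))) \<and>
     (\<forall>q p l. (q, p) \<in> r \<longrightarrow> (p, l) \<in> r \<longrightarrow>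
        iso_to_field s (space_at M q) \<longrightarrow> iso_to_field s (space_at M l) \<longrightarrow>
        iso_to_field s (space_at M p))"

end

theory Submission
  imports Defs "HOL-Analysis.Cartesian_Space"
begin

text \<open>
  A basis vector of \<open>S(q)\<close> in a semi-component module is sent either to a basis vector or to \<open>0\<close>;
  the second case is all that separates \<open>S\<close> from a component module. To give the dying basis
  vectors somewhere to go, take for \<open>I\<close> the constant module with value \<open>\<K>\<close> and identity
  maps, and let \<open>C\<close> be \<open>S \<oplus> I\<close> itself. The support of an interval module has to be convex but
  need not be connected, so the constant module is one for every \<open>P\<close>.

  Every space of \<open>C\<close> carries a sheared basis: from a basis \<open>B\<close> of \<open>S(q)\<close> form the vectors
  \<open>(b, 1)\<close> with \<open>b \<in> B \<union> {0}\<close> (lemma \<open>is_basis_lifted_basis\<close>). Since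
  the second coordinate is preserved, a structure map sends \<open>(b, 1)\<close> to \<open>(b', 1)\<close> if \<open>b \<mapsto> b'\<close>,
  and to \<open>(0, 1)\<close> if \<open>b \<mapsto> 0\<close>; it fixes \<open>(0, 1)\<close>. Hence sheared basis vectors
  go to sheared basis vectors, which is to say that the matrices have exactly one 1 in each
  column and zeros elsewhere.
\<close>

section \<open>Bases and columns with entries 0 and 1\<close>

text \<open>
  A vector is determined by its coordinates: if they all vanish, it is \<open>0\<close>, and if the only
  nonzero one is a single 1, it is the corresponding basis vector.
\<close>

lemma zero_or_basis_vector_if_at_most_one_1:
  assumes "vector_space s" and basis: "is_basis s W B" and w: "w \<in> W"
    and entries: "\<forall>b\<in>B. module.representation s B w b \<in> {0, 1}"
    and at_most_one: "\<exists>\<^sub>\<le>\<^sub>1b. b \<in> B \<and> module.representation s B w b = 1"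
  shows "w \<in> insert 0 B"
proof -
  interpret vector_space s by fact
  have ind: "independent B" and span: "w \<in> span B"
    using basis w by (auto simp: is_basis_def)
  have w_eq: "(\<Sum>b | representation B w b \<noteq> 0. s (representation B w b) b) = w"
    using sum_nonzero_representation_eq[OF ind span] .
  have in_B: "b \<in> B" if "representation B w b \<noteq> 0" for b
    using that representation_ne_zero by blast
  show ?thesis
  proof (cases "\<exists>b. representation B w b \<noteq> 0")
    case True
    then obtain b where b: "representation B w b \<noteq> 0" by blast
    with in_B entries have b1: "b \<in> B" "representation B w b = 1" by auto
    have "c = b" if "representation B w c \<noteq> 0" for c
    proof -
      have "c \<in> B" "representation B w c = 1" using that in_B entries by auto
      with b1 show ?thesis using Uniq_D[OF at_most_one, of c b] by blast
    qed
    with b have support: "{c. representation B w c \<noteq> 0} = {b}" by blast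
    have "w = s (representation B w b) b"
      by (subst w_eq[symmetric]) (simp only: support, simp)
    also have "\<dots> = b" by (simp only: b1 scale_one)
    finally show ?thesis using b1 by blast
  next
    case False
    with w_eq show ?thesis by simp
  qed
qed

lemma matrix_entry_if_image_in_basis:
  assumes "vector_space s" "is_basis s W B" "f b \<in> B"
  shows "matrix_entry s B f b' b = (if b' = f b then 1 else 0)"
proof -
  interpret vector_space s by fact
  show ?thesis
    using assms representation_basis[of B "f b"] by (simp add: matrix_entry_def is_basis_def)
qed

lemma vector_space_prod_scale_field:
  fixes s :: "'k::field \<Rightarrow> 'v::ab_group_add \<Rightarrow> 'v"
  assumes "vector_space s"
  shows "vector_space_prod s ((*) :: 'k \<Rightarrow> 'k \<Rightarrow> 'k)"
  using assms vector_space_over_itself.vector_space_axioms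
  by (simp add: vector_space_prod_def vector_space_pair_def)

section \<open>Lifting a basis of V to a sheared basis of V x K\<close>

definition lifted_basis :: "'v::zero set \<Rightarrow> ('v \<times> 'k::one) set" where
  "lifted_basis B = (\<lambda>b. (b, 1)) ` insert 0 B"

text \<open>
  In a vanishing linear combination the first coordinate kills the coefficients of all \<open>(b, 1)\<close>
  with \<open>b \<noteq> 0\<close>, after which the second coordinate kills the coefficient of \<open>(0, 1)\<close>.
  Differences \<open>(b, 1) - (0, 1)\<close> give back the vectors \<open>(b, 0)\<close>, so the set also spans.
\<close>

lemma is_basis_lifted_basis:
  fixes s :: "'k::field \<Rightarrow> 'v::ab_group_add \<Rightarrow> 'v"
  assumes "vector_space s" and basis: "is_basis s V B"
  shows "is_basis (module_prod.scale s (*)) (V \<times> (UNIV :: 'k set)) (lifted_basis B)"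
proof -
  interpret vector_space_prod s "(*) :: 'k \<Rightarrow> 'k \<Rightarrow> 'k"
    using assms by (intro vector_space_prod_scale_field)
  let ?L = "lifted_basis B :: ('v \<times> 'k) set"
  have ind: "vs1.independent B" and span: "vs1.span B = V"
    using basis by (auto simp: is_basis_def)
  have "p.independent ?L"
    unfolding p.independent_explicit_module
  proof (intro allI impI)
    fix T u and x :: "'v \<times> 'k"
    assume T: "finite T" "T \<subseteq> ?L" and sum0: "(\<Sum>y\<in>T. scale (u y) y) = 0" and x: "x \<in> T"
    have snd1: "snd y = 1" and fst_in: "fst y \<in> insert 0 B" if "y \<in> T" for y
      using that T(2) by (auto simp: lifted_basis_def)
    have inj: "inj_on fst T"
      using snd1 by (intro inj_onI prod_eqI) simp_all
    let ?T' = "{y \<in> T. fst y \<noteq> 0}"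
    have inj': "inj_on fst ?T'"
      using inj by (rule inj_on_subset) auto
    have "(\<Sum>y\<in>T. s (u y) (fst y)) = 0"
      using arg_cong[OF sum0, of fst] by (simp add: fst_sum scale_def)
    then have "(\<Sum>y\<in>?T'. s (u y) (fst y)) = 0"
      using T(1) by (subst sum.mono_neutral_left[of T]) auto
    then have comb: "(\<Sum>b\<in>fst ` ?T'. s (u (b, 1)) b) = 0"
    proof -
      have "(fst y, 1) = y" if "y \<in> ?T'" for y
        using that snd1 by (simp add: prod_eq_iff)
      then have "(\<Sum>y\<in>?T'. s (u (fst y, 1)) (fst y)) = (\<Sum>y\<in>?T'. s (u y) (fst y))"
        by (intro sum.cong refl) simp
      then show ?thesis
        using \<open>(\<Sum>y\<in>?T'. s (u y) (fst y)) = 0\<close> by (simp add: sum.reindex[OF inj'] o_def)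
    qed
    have vanish: "u y = 0" if "y \<in> T" "fst y \<noteq> 0" for y
    proof -
      have "u (fst y, 1) = 0"
      proof (rule vs1.independentD[OF ind, where u = "\<lambda>b. u (b, 1)"])
        show "finite (fst ` ?T')" using T(1) by simp
        show "fst ` ?T' \<subseteq> B" using fst_in by auto
        show "(\<Sum>b\<in>fst ` ?T'. s (u (b, 1)) b) = 0" by (rule comb)
        show "fst y \<in> fst ` ?T'" using that by simp
      qed
      then show ?thesis using snd1[OF that(1)] by (metis prod.collapse)
    qed
    show "u x = 0"
    proof (cases "fst x = 0")
      case True
      have others: "u y = 0" if "y \<in> T" "y \<noteq> x" for y
        using that vanish snd1 x True by (metis prod_eqI)
      have "0 = (\<Sum>y\<in>T. u y * snd y)"
        using arg_cong[OF sum0, of snd] by (simp add: snd_sum scale_def)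
      also have "\<dots> = (\<Sum>y\<in>{x}. u y * snd y)"
        using others x T(1) by (intro sum.mono_neutral_right) auto
      also have "\<dots> = u x" using snd1[OF x] by simp
      finally show ?thesis by simp
    qed (use vanish x in blast)
  qed
  moreover have "p.span ?L = V \<times> UNIV"
  proof
    have "p.subspace (V \<times> UNIV)"
      using span vs1.subspace_span
      by (intro subspace_Times vector_space_over_itself.subspace_UNIV) auto
    moreover have "?L \<subseteq> V \<times> UNIV"
      using span vs1.span_superset[of B] vs1.span_zero[of B] by (auto simp: lifted_basis_def)
    ultimately show "p.span ?L \<subseteq> V \<times> UNIV"
      by (rule p.span_minimal[rotated])
  next
    have "(0, 1) \<in> p.span ?L"
      by (rule p.span_base) (simp add: lifted_basis_def)
    then have vertical: "(0, c) \<in> p.span ?L" for c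
      using p.span_scale[of "(0, 1)" ?L c] by (simp add: scale_def)
    have "(b, 1) - (0, 1) \<in> p.span ?L" if "b \<in> B" for b
      using that by (intro p.span_diff p.span_base) (auto simp: lifted_basis_def)
    then have "B \<subseteq> (\<lambda>v. (v, 0)) -` p.span ?L" by auto
    moreover have "vs1.subspace ((\<lambda>v. (v, 0)) -` p.span ?L)"
    proof (rule vs1.subspaceI)
      show "0 \<in> (\<lambda>v. (v, 0)) -` p.span ?L" using vertical by simp
      show "x + y \<in> (\<lambda>v. (v, 0)) -` p.span ?L"
        if "x \<in> (\<lambda>v. (v, 0)) -` p.span ?L" "y \<in> (\<lambda>v. (v, 0)) -` p.span ?L" for x y
        using p.span_add[of "(x, 0)" ?L "(y, 0)"] that by simp
      show "s c x \<in> (\<lambda>v. (v, 0)) -` p.span ?L"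
        if "x \<in> (\<lambda>v. (v, 0)) -` p.span ?L" for c x
        using p.span_scale[of "(x, 0)" ?L c] that by (simp add: scale_def)
    qed
    ultimately have horizontal: "(v, 0) \<in> p.span ?L" if "v \<in> V" for v
      using vs1.span_minimal span that by blast
    show "V \<times> UNIV \<subseteq> p.span ?L"
    proof clarify
      fix v and c :: 'k
      assume "v \<in> V"
      then show "(v, c) \<in> p.span ?L"
        using p.span_add[OF horizontal vertical, of v c] by simp
    qed
  qed
  ultimately show ?thesis by (simp add: is_basis_def)
qed

section \<open>The constant module\<close>

definition constant_module :: "('p, 'k) pmod" where
  "constant_module = \<lparr>space_at = (\<lambda>_. UNIV), map_at = (\<lambda>_ _ x. x)\<rparr>"

lemma is_basis_field: "is_basis (*) (UNIV :: 'k::field set) {1}"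
  by (auto simp: is_basis_def vector_space_over_itself.span_singleton)

lemma persistence_module_constant_module:
  "persistence_module P r (*) (constant_module :: ('p, 'k::field) pmod)"
proof -
  have "fin_dim_subspace (*) (UNIV :: 'k set)"
    unfolding fin_dim_subspace_def using is_basis_field
    by (intro conjI exI[of _ "{1}"] vector_space_over_itself.subspace_UNIV) auto
  then show ?thesis
    using vector_space_over_itself.vector_space_axioms
    by (auto simp: persistence_module_def constant_module_def linear_map_def)
qed

lemma interval_module_constant_module:
  "interval_module P r (*) (constant_module :: ('p, 'k::field) pmod)"
proof -
  let ?K = "constant_module :: ('p, 'k) pmod"
  have "linear_iso (*) (*) (UNIV :: 'k set) UNIV id"
    by (simp add: linear_iso_def linear_map_def)
  then have iso: "iso_to_field (*) (space_at ?K q)" for q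
    unfolding iso_to_field_def constant_module_def by auto
  have basis: "is_basis (*) (space_at ?K q) {1}" for q
    using is_basis_field by (simp add: constant_module_def)
  have "matrix_entry (*) {1} (map_at ?K q p) 1 1 = 1" for q p
    using matrix_entry_if_image_in_basis[OF vector_space_over_itself.vector_space_axioms
        is_basis_field, of "map_at ?K q p" 1 1]
    by (simp add: constant_module_def)
  with basis iso persistence_module_constant_module show ?thesis
    unfolding interval_module_def
    by (intro conjI exI[of _ "\<lambda>_. {1}"]) auto
qed

section \<open>Adding the constant module to a semi-component module\<close>

lemma persistence_module_direct_sum_constant_module:
  fixes s :: "'k::field \<Rightarrow> 'v::ab_group_add \<Rightarrow> 'v"
  assumes "persistence_module P r s M"
  shows "persistence_module P r (module_prod.scale s (*))
           (direct_sum M (constant_module :: ('p, 'k) pmod))"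
proof -
  have vs: "vector_space s" using assms by (simp add: persistence_module_def)
  then interpret vector_space_prod s "(*) :: 'k \<Rightarrow> 'k \<Rightarrow> 'k"
    by (rule vector_space_prod_scale_field)
  have "fin_dim_subspace scale (V \<times> (UNIV :: 'k set))" if "fin_dim_subspace s V" for V
  proof -
    obtain B where "finite B" "is_basis s V B"
      using \<open>fin_dim_subspace s V\<close> by (auto simp: fin_dim_subspace_def)
    then have basis: "is_basis scale (V \<times> (UNIV :: 'k set)) (lifted_basis B)"
      and fin: "finite (lifted_basis B :: ('v \<times> 'k) set)"
      using is_basis_lifted_basis[OF vs] by (auto simp: lifted_basis_def)
    from basis have "p.subspace (V \<times> (UNIV :: 'k set))"
      by (metis is_basis_def p.subspace_span)
    with basis fin show ?thesis by (auto simp: fin_dim_subspace_def)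
  qed
  then show ?thesis
    using assms p.vector_space_axioms
    unfolding persistence_module_def direct_sum_def constant_module_def
    by (fastforce simp: linear_map_def scale_def)
qed

lemma component_module_direct_sum_constant_module:
  fixes s :: "'k::field \<Rightarrow> 'v::ab_group_add \<Rightarrow> 'v"
  assumes order: "r \<subseteq> P \<times> P" and semi: "semi_component_module P r s M"
  shows "component_module P r (module_prod.scale s (*))
           (direct_sum M (constant_module :: ('p, 'k) pmod))"
proof -
  let ?t = "module_prod.scale s ((*) :: 'k \<Rightarrow> 'k \<Rightarrow> 'k)"
  let ?C = "direct_sum M (constant_module :: ('p, 'k) pmod)"
  have pers: "persistence_module P r s M"
    using semi by (simp add: semi_component_module_def)
  then have vs: "vector_space s" by (simp add: persistence_module_def)
  interpret vector_space_prod s "(*) :: 'k \<Rightarrow> 'k \<Rightarrow> 'k"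
    using vs by (rule vector_space_prod_scale_field)
  obtain B where B: "\<And>q. q \<in> P \<Longrightarrow> is_basis s (space_at M q) (B q)"
    and columns: "\<And>q p b. (q, p) \<in> r \<Longrightarrow> b \<in> B q \<Longrightarrow>
        (\<forall>b'\<in>B p. matrix_entry s (B p) (map_at M q p) b' b \<in> {0, 1}) \<and>
        (\<exists>\<^sub>\<le>\<^sub>1b'. b' \<in> B p \<and> matrix_entry s (B p) (map_at M q p) b' b = 1)"
    using semi unfolding semi_component_module_def by blast
  let ?L = "\<lambda>q. lifted_basis (B q) :: ('v \<times> 'k) set"
  have basis: "is_basis ?t (space_at ?C q) (?L q)" if "q \<in> P" for q
    using is_basis_lifted_basis[OF vs B[OF that]]
    by (simp add: direct_sum_def constant_module_def)
  have image: "map_at ?C q p x \<in> ?L p" if qp: "(q, p) \<in> r" and x: "x \<in> ?L q" for q p x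
  proof -
    have P: "q \<in> P" "p \<in> P" using order qp by auto
    have lin: "linear_map s s (space_at M q) (space_at M p) (map_at M q p)"
      using pers qp by (auto simp: persistence_module_def)
    have space: "space_at M q = vs1.span (B q)"
      using B[OF P(1)] by (simp add: is_basis_def)
    obtain b where b: "b \<in> insert 0 (B q)" and x_eq: "x = (b, 1)"
      using x by (auto simp: lifted_basis_def)
    have "map_at M q p b \<in> insert 0 (B p)"
    proof (cases "b = 0")
      case True
      have "0 \<in> space_at M q" using space vs1.span_zero by simp
      then have "map_at M q p (s 0 0) = s 0 (map_at M q p 0)"
        using lin unfolding linear_map_def by blast
      with True show ?thesis by simp
    next
      case False
      with b have bB: "b \<in> B q" by simp
      then have "map_at M q p b \<in> space_at M p"
        using lin space vs1.span_base by (auto simp: linear_map_def)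
      then show ?thesis
        using zero_or_basis_vector_if_at_most_one_1[OF vs B[OF P(2)]] columns[OF qp bB]
        unfolding matrix_entry_def by blast
    qed
    then show ?thesis
      by (auto simp: x_eq lifted_basis_def direct_sum_def constant_module_def)
  qed
  have entry: "matrix_entry ?t (?L p) (map_at ?C q p) y x = (if y = map_at ?C q p x then 1 else 0)"
    if "(q, p) \<in> r" "x \<in> ?L q" for q p x y
  proof (rule matrix_entry_if_image_in_basis)
    show "vector_space ?t" by (rule p.vector_space_axioms)
    show "is_basis ?t (space_at ?C p) (?L p)" using basis that order by blast
    show "map_at ?C q p x \<in> ?L p" using image that by blast
  qed
  have column: "(\<forall>y\<in>?L p. matrix_entry ?t (?L p) (map_at ?C q p) y x \<in> {0, 1}) \<and>
      (\<exists>!y. y \<in> ?L p \<and> matrix_entry ?t (?L p) (map_at ?C q p) y x = 1)"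
    if "(q, p) \<in> r" "x \<in> ?L q" for q p x
  proof (intro conjI ex1I[of _ "map_at ?C q p x"])
    show "y = map_at ?C q p x"
      if "y \<in> ?L p \<and> matrix_entry ?t (?L p) (map_at ?C q p) y x = 1" for y
      using that entry[OF \<open>(q, p) \<in> r\<close> \<open>x \<in> ?L q\<close>, of y] by (simp split: if_splits)
  qed (simp_all add: entry image that)
  have "\<forall>(q, p)\<in>r. \<forall>x\<in>?L q.
      (\<forall>y\<in>?L p. matrix_entry ?t (?L p) (map_at ?C q p) y x \<in> {0, 1}) \<and>
      (\<exists>!y. y \<in> ?L p \<and> matrix_entry ?t (?L p) (map_at ?C q p) y x = 1)"
    by (intro ballI case_prodI2) (rule column; simp)
  moreover have "\<forall>q\<in>P. is_basis ?t (space_at ?C q) (?L q)" using basis by (rule ballI)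
  ultimately show ?thesis
    unfolding component_module_def
    by (intro conjI exI[of _ ?L] persistence_module_direct_sum_constant_module[OF pers])
qed

lemma isomorphic_modules_refl: "isomorphic_modules P r s s M M"
  unfolding isomorphic_modules_def linear_iso_def linear_map_def
  by (intro exI[of _ "\<lambda>_. id"]) auto

theorem theorem5p9:
  fixes P :: "'p set" and r :: "'p rel"
    and scale :: "'k::field \<Rightarrow> 'v::ab_group_add \<Rightarrow> 'v"
    and S :: "('p, 'v) pmod"
  assumes "finite P"
    and "partial_order_on P r"
    and "semi_component_module P r scale S"
  shows "\<exists>(C :: ('p, 'v \<times> 'k) pmod) (I :: ('p, 'k) pmod).
           component_module P r (module_prod.scale scale (*)) C \<and>
           interval_module P r (*) I \<and>
           isomorphic_modules P r (module_prod.scale scale (*)) (module_prod.scale scale (*))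
             C (direct_sum S I)"
proof -
  have "r \<subseteq> P \<times> P"
    using assms(2) by (simp add: partial_order_on_def preorder_on_def)
  then show ?thesis
    using component_module_direct_sum_constant_module[OF _ assms(3)]
      interval_module_constant_module isomorphic_modules_refl
    by blast
qed

end
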